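(* Let $E$ be a connected finite graph with disjoint cycles. Then $E$ can be transformed, by a finite sequence of moves each of which is a graph isomorphism, an in-splitting or an out-splitting, into a graph with disjoint cycles in quasi-normal form.
   Context: A (directed) graph $E=(E^0,E^1,s,r)$ has a vertex set $E^0$, an edge set $E^1$ (parallel edges and loops allowed), and source and range maps $s,r:E^1\to E^0$; it is finite if $E^0$ and $E^1$ are finite. A path of length $n\ge 1$ is $e_1\cdots e_n$ with $r(e_i)=s(e_{i+1})$; vertices are paths of length $0$. A cycle is a path $e_1\cdots e_n$ ($n\ge1$) with $r(e_n)=s(e_1)$ and $s(e_1),\dots,s(e_n)$ distinct (cycles differing by a cyclic rotation define the same cycle $C$; $C^0$ is its vertex set, $|C|$ its length). A graph with disjoint cycles is a graph in which every vertex is the base of at most one cycle. $\mathcal C_E$ is the set of cycles of $E$ and $\mathcal C_E^0=\bigcup_{C\in\mathcal C_E}C^0$. Trails: a trail is a path $\alpha=e_1\cdots e_n$ ($n\ge 1$) with $s(e_1),r(e_n)\in\mathcal C_E^0$ and $s(e_i)\notin\mathcal C_E^0$ for $1<i\le n$. It is a trail from $A$ to $B$ if $s(\alpha)\in A^0$ and $r(\alpha)\in B^0$. The interior vertices of $\alpha$ are the vertices on $\alpha$ not in $\mathcal C_E^0$. Quasi-normal form: a connected finite graph with disjoint cycles $C_1,\dots,C_n$ is in quasi-normal form if (1) any two distinct trails have no common interior vertices; and (2) there are distinguished vertices $v_i\in C_i^0$ $(1\le i\le n)$ (the vertices of index $1$; the other vertices of $C_i$ are numbered cyclically following the edges of $C_i$)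 such that, for all $i\ne j$, every trail from $C_i$ to $C_j$ starts at $v_i$ and ends at $v_j$. In-splitting: for each $v\in E^0$ with $r^{-1}(v)\neq\emptyset$ choose a partition $\{\mathcal E^v_1,\dots,\mathcal E^v_{m(v)}\}$ of $r^{-1}(v)$ into nonempty sets; if $r^{-1}(v)=\emptyset$ put $m(v)=1$, $v_1=v$. The resulting in-splitting $F$ of $E$ has vertices $v_i$ ($v\in E^0$, $1\le i\le m(v)$) and edges $e_j$ ($e\in E^1$, $1\le j\le m(s(e))$), with $s(e_j)=s(e)_j$ and $r(e_j)=r(e)_i$ where $e\in\mathcal E^{r(e)}_i$. An out-splitting of $E$ is a graph $F$ whose transpose (all edges reversed) is an in-splitting of the transpose of $E$. *)

theory Defs
  imports "Graph_Theory.Digraph_Isomorphism" "HOL-Library.Disjoint_Sets"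
begin

text \<open>
  Sources and ranges are given by \<open>tail\<close> and \<open>head\<close>; parallel edges and loops are allowed.
  Finite graphs are those satisfying \<open>fin_digraph\<close>, and \<open>connected\<close> is the library's notion:
  nonempty with connected underlying undirected graph.
\<close>

text \<open>A cycle modulo cyclic rotation, represented by the set of its rotations.\<close>

definition cycles_of :: "('a, 'b) pre_digraph \<Rightarrow> 'b list set set" where
  "cycles_of G = (\<lambda>p. range (\<lambda>k. rotate k p)) ` {p. pre_digraph.cycle G p}"

definition cycle_verts :: "('a, 'b) pre_digraph \<Rightarrow> 'b list set \<Rightarrow> 'a set" where
  "cycle_verts G C = (\<Union>p\<in>C. tail G ` set p)"

definition cyclic_verts :: "('a, 'b) pre_digraph \<Rightarrow> 'a set" where
  "cyclic_verts G = (\<Union>C\<in>cycles_of G. cycle_verts G C)"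

definition disjoint_cycles :: "('a, 'b) pre_digraph \<Rightarrow> bool" where
  "disjoint_cycles G \<longleftrightarrow>
     (\<forall>v\<in>verts G. \<exists>\<^sub>\<le>\<^sub>1 C. C \<in> cycles_of G \<and> v \<in> cycle_verts G C)"

text \<open>
  Trails in the present sense, unrelated to the library's \<open>trail\<close> (a walk without repeated arcs).
  A single edge of a cycle is also such a trail.
\<close>

definition cycle_trail :: "('a, 'b) pre_digraph \<Rightarrow> 'b list \<Rightarrow> bool" where
  "cycle_trail G p \<longleftrightarrow> p \<noteq> [] \<and>
     (\<exists>u\<in>cyclic_verts G. \<exists>v\<in>cyclic_verts G. pre_digraph.awalk G u p v) \<and>
     (\<forall>e\<in>set (tl p). tail G e \<notin> cyclic_verts G)"

definition trail_source :: "('a, 'b) pre_digraph \<Rightarrow> 'b list \<Rightarrow> 'a" where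
  "trail_source G p = tail G (hd p)"

definition trail_range :: "('a, 'b) pre_digraph \<Rightarrow> 'b list \<Rightarrow> 'a" where
  "trail_range G p = head G (last p)"

definition cycle_trail_between ::
  "('a, 'b) pre_digraph \<Rightarrow> 'b list set \<Rightarrow> 'b list \<Rightarrow> 'b list set \<Rightarrow> bool" where
  "cycle_trail_between G A p B \<longleftrightarrow> cycle_trail G p \<and>
     trail_source G p \<in> cycle_verts G A \<and> trail_range G p \<in> cycle_verts G B"

definition interior_verts :: "('a, 'b) pre_digraph \<Rightarrow> 'b list \<Rightarrow> 'a set" where
  "interior_verts G p = (tail G ` set p \<union> head G ` set p) - cyclic_verts G"

text \<open>
  The function \<open>d\<close> selects the distinguished vertex, of index 1, of each cycle; the indices of
  the other vertices of the cycle are then determined and play no role in the conditions.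
\<close>

definition quasi_normal_form :: "('a, 'b) pre_digraph \<Rightarrow> bool" where
  "quasi_normal_form G \<longleftrightarrow>
     fin_digraph G \<and> Digraph_Component.connected G \<and> disjoint_cycles G \<and>
     (\<forall>p q. cycle_trail G p \<and> cycle_trail G q \<and> p \<noteq> q \<longrightarrow>
        interior_verts G p \<inter> interior_verts G q = {}) \<and>
     (\<exists>d. (\<forall>C\<in>cycles_of G. d C \<in> cycle_verts G C) \<and>
        (\<forall>A\<in>cycles_of G. \<forall>B\<in>cycles_of G. A \<noteq> B \<longrightarrow>
           (\<forall>p. cycle_trail_between G A p B \<longrightarrow>
              trail_source G p = d A \<and> trail_range G p = d B)))"

text \<open>
  The sets \<open>P v 1, \<dots>, P v (m v)\<close> are the classes of the chosen partition of the edges into \<open>v\<close>;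
  injectivity says that they are listed without repetition.
\<close>

definition in_splitting_data ::
  "('a, 'b) pre_digraph \<Rightarrow> ('a \<Rightarrow> nat) \<Rightarrow> ('a \<Rightarrow> nat \<Rightarrow> 'b set) \<Rightarrow> bool" where
  "in_splitting_data G m P \<longleftrightarrow> (\<forall>v\<in>verts G.
     if in_arcs G v = {} then m v = 1
     else partition_on (in_arcs G v) (P v ` {1..m v}) \<and> inj_on (P v) {1..m v})"

definition in_split_graph ::
  "('a, 'b) pre_digraph \<Rightarrow> ('a \<Rightarrow> nat) \<Rightarrow> ('a \<Rightarrow> nat \<Rightarrow> 'b set) \<Rightarrow> ('a \<times> nat, 'b \<times> nat) pre_digraph"
where
  "in_split_graph G m P = \<lparr>
     verts = (SIGMA v:verts G. {1..m v}),
     arcs = (SIGMA e:arcs G. {1..m (tail G e)}),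
     tail = (\<lambda>(e, j). (tail G e, j)),
     head = (\<lambda>(e, j). (head G e, THE i. i \<in> {1..m (head G e)} \<and> e \<in> P (head G e) i))\<rparr>"

text \<open>The names of the vertices and edges of a splitting are immaterial.\<close>

definition in_splitting :: "('a, 'b) pre_digraph \<Rightarrow> ('c, 'd) pre_digraph \<Rightarrow> bool" where
  "in_splitting E F \<longleftrightarrow>
     (\<exists>m P. in_splitting_data E m P \<and> digraph_iso (in_split_graph E m P) F)"

definition transpose_graph :: "('a, 'b) pre_digraph \<Rightarrow> ('a, 'b) pre_digraph" where
  "transpose_graph G = \<lparr>verts = verts G, arcs = arcs G, tail = head G, head = tail G\<rparr>"

definition out_splitting :: "('a, 'b) pre_digraph \<Rightarrow> ('c, 'd) pre_digraph \<Rightarrow> bool" where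
  "out_splitting E F \<longleftrightarrow> in_splitting (transpose_graph E) (transpose_graph F)"

definition splitting_move :: "('a, 'b) pre_digraph \<Rightarrow> ('c, 'd) pre_digraph \<Rightarrow> bool" where
  "splitting_move E F \<longleftrightarrow> digraph_iso E F \<or> in_splitting E F \<or> out_splitting E F"

text \<open>
  Finite sequences of moves. All graphs after the first one have natural numbers as vertices and
  edges. This is no restriction for a finite \<open>E\<close>: isomorphisms are moves, so the first move may
  just rename, and each splitting of a finite graph is isomorphic to a graph on natural numbers.
\<close>

definition transformable :: "('a, 'b) pre_digraph \<Rightarrow> (nat, nat) pre_digraph \<Rightarrow> bool" where
  "transformable E F \<longleftrightarrow> (\<exists>E'. splitting_move E E' \<and> splitting_move\<^sup>*\<^sup>* E' F)"

end

theory Submission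
  imports Defs
begin

text \<open>
  Choose one vertex on every cycle, and let \<open>D\<close> be the set of these vertices. Suppose that every vertex
  outside \<open>D\<close> that is neither a sink nor a source has exactly one incoming and one outgoing arc. Then
  the graph is in quasi-normal form, with \<open>D\<close> as the distinguished vertices
  (\<open>thin_imp_quasi_normal_form\<close>). Indeed, an interior vertex of a trail determines the trail, and a
  vertex of a cycle outside \<open>D\<close> has no arcs besides those of the cycle, so trails between different
  cycles must start and end in \<open>D\<close>.

  Such a graph is reached by splitting these vertices, cyclic or not, as finely as possible. In one
  in-splitting, give each of them one copy per incoming arc (\<open>thinning_in_splitting\<close>). If the tail of
  the arc is in \<open>D\<close>, or has in-degree 1, it is not multiplied, and the copy has in-degree 1. Since all
  cycles pass through \<open>D\<close>, the arcs avoiding \<open>D\<close> carry a rank function, and repeating the move makes the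
  in-degrees 1 rank by rank. For a cyclic vertex, one copy remains on the cycle and the others are
  no longer cyclic; this shifts the end points of trails along the cycle towards the distinguished vertex.
  Afterwards the same is done in the transpose, by out-splittings. As in-splittings preserve
  out-degrees and out-splittings preserve in-degrees, the two phases do not disturb each other.

  It remains to see that the splittings preserve the hypotheses. An in-splitting projects to the
  original graph bijectively on the arcs leaving a vertex (locale \<open>covering\<close>). Cycles are disjoint if
  and only if arcs lying on cycles are determined by their tails
  (\<open>disjoint_cycles_iff_inj_on_recurrent_arcs\<close>), and this passes to the splitting at once, as does the
  choice of \<open>D\<close>, whose vertices are never split. Connectedness is preserved because sinks are not
  in-split and sources are not out-split.
\<close>

section \<open>Disjoint cycles and recurrent arcs\<close>

text \<open>
  These are the arcs that lie on a cycle. Defining them by reachability makes it immediate that a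
  map of graphs preserves them.
\<close>

definition recurrent_arcs :: "('a, 'b) pre_digraph \<Rightarrow> 'b set" where
  "recurrent_arcs G = {e \<in> arcs G. (head G e, tail G e) \<in> (arcs_ends G)\<^sup>*}"

lemma in_arcs_ends: "e \<in> arcs G \<Longrightarrow> (tail G e, head G e) \<in> arcs_ends G"
  by (auto simp: arcs_ends_conv)

lemma (in wf_digraph) reachable_iff_rtrancl:
  assumes "u \<in> verts G"
  shows "u \<rightarrow>\<^sup>*\<^bsub>G\<^esub> v \<longleftrightarrow> (u, v) \<in> (arcs_ends G)\<^sup>*"
  using assms by (auto simp: reachable_rtranclI rtrancl_eq_or_trancl)

lemma (in wf_digraph) recurrent_arc_on_cycle:
  assumes "e \<in> recurrent_arcs G"
  obtains q where "cycle (e # q)"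
proof -
  have e: "e \<in> arcs G" and "(head G e, tail G e) \<in> (arcs_ends G)\<^sup>*"
    using assms by (auto simp: recurrent_arcs_def)
  then have "head G e \<rightarrow>\<^sup>*\<^bsub>G\<^esub> tail G e" by (simp add: reachable_iff_rtrancl)
  then obtain q where "apath (head G e) q (tail G e)" by (auto simp: reachable_apath)
  then have "awalk (tail G e) (e # q) (tail G e) \<and> distinct (tl (awalk_verts (tail G e) (e # q)))"
    using e by (auto simp: apath_def awalk_Cons_iff)
  then show thesis using that by (auto simp: cycle_def)
qed

lemma (in wf_digraph) cycleE:
  assumes "cycle p"
  obtains u where "awalk u p u" "p \<noteq> []" "distinct (map (tail G) p)"
    "head G ` set p = tail G ` set p"
proof -
  obtain u where u: "awalk u p u" "distinct (tl (awalk_verts u p))" "p \<noteq> []"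
    using assms by (auto simp: cycle_def)
  have lst: "awalk_verts u p = map (tail G) p @ [u]"
    using u by (auto simp: awalk_verts_conv dest: awlast_of_awalk)
  obtain e q where p: "p = e # q" using u by (cases p) auto
  have e: "tail G e = u" using u p by (auto simp: awalk_Cons_iff)
  have 1: "distinct (map (tail G) p)" using u(2) lst e by (auto simp: p)
  have "awalk_verts u p = u # map (head G) p"
    using u awalk_verts_conv'[of u p u] by (auto simp: awalk_def cas_simp)
  then have "set (map (head G) p) = set (tl (awalk_verts u p))" by simp
  also have "\<dots> = tail G ` set p" using lst e by (auto simp: p)
  finally show thesis using that u 1 by simp
qed

lemma range_rotate_rotate: "range (\<lambda>k. rotate k (rotate m p)) = range (\<lambda>k. rotate k p)"
proof (intro equalityI subsetI)
  fix x assume "x \<in> range (\<lambda>k. rotate k (rotate m p))"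
  then show "x \<in> range (\<lambda>k. rotate k p)" by (auto simp: rotate_rotate)
next
  fix x assume "x \<in> range (\<lambda>k. rotate k p)"
  then obtain k where k: "x = rotate k p" by auto
  show "x \<in> range (\<lambda>k. rotate k (rotate m p))"
  proof (cases "p = []")
    case False
    \<comment> \<open>the second rotation is \<open>k - m\<close> modulo the length, kept nonnegative\<close>
    have "rotate (k + (length p * m - m)) (rotate m p) = rotate (k + length p * m) p"
      using False by (simp add: rotate_rotate) (metis (no_types, lifting) One_nat_def add.assoc
        le_add_diff_inverse2 length_greater_0_conv mult.commute mult_le_mono2 nat_mult_1_right Suc_leI)
    also have "\<dots> = x" using k by (metis mod_mult_self2 rotate_conv_mod)
    finally show ?thesis by (metis rangeI)
  qed (use k in auto)
qed

lemma cycle_verts_rotations: "cycle_verts G (range (\<lambda>k. rotate k p)) = tail G ` set p"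
  by (auto simp: cycle_verts_def)

text \<open>
  A cycle may be entered anywhere: it has a rotation starting at each of its arcs.
\<close>

lemma (in wf_digraph) cycle_at:
  assumes "cycle p" "e \<in> set p"
  obtains q where "awalk (head G e) q (tail G e)" "tail G e \<notin> tail G ` set q"
    "set (e # q) = set p"
    "range (\<lambda>k. rotate k p) = range (\<lambda>k. rotate k (e # q))"
proof -
  obtain u where u: "awalk u p u" "p \<noteq> []" "distinct (map (tail G) p)" 
    using assms by (elim cycleE) 
  obtain xs ys where p: "p = xs @ e # ys" using assms(2) by (meson split_list)
  have "rotate (length xs) p = e # ys @ xs" by (simp add: p rotate_append)
  then have r: "range (\<lambda>k. rotate k p) = range (\<lambda>k. rotate k (e # ys @ xs))"
    by (metis range_rotate_rotate)
  show thesis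
  proof (rule that[of "ys @ xs"])
    show "awalk (head G e) (ys @ xs) (tail G e)"
      using u(1) unfolding p by (auto simp: awalk_Cons_iff)
    show "tail G e \<notin> tail G ` set (ys @ xs)" using u(3) unfolding p by auto
  qed (use r p in auto)
qed

lemma (in wf_digraph) awalk_rtrancl: "awalk u p v \<Longrightarrow> (u, v) \<in> (arcs_ends G)\<^sup>*"
  using reachable_awalk reachable_rtranclI by metis

lemma (in wf_digraph) cycle_arcs_recurrent:
  assumes "cycle p"
  shows "set p \<subseteq> recurrent_arcs G"
proof
  fix e assume e: "e \<in> set p"
  have "e \<in> arcs G" using assms e by (auto simp: cycle_def awalk_def)
  with cycle_at[OF assms e] show "e \<in> recurrent_arcs G"
    by (metis (mono_tags, lifting) awalk_rtrancl mem_Collect_eq recurrent_arcs_def)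
qed

text \<open>
  Each vertex leaves no choice for the next arc, and both walks stop on their first visit of \<open>v\<close>.
\<close>

lemma (in wf_digraph) deterministic_awalk_unique:
  assumes "inj_on (tail G) R"
    and "awalk x p v" "awalk x q v" "set p \<subseteq> R" "set q \<subseteq> R"
    and "v \<notin> tail G ` set p" "v \<notin> tail G ` set q"
  shows "p = q"
  using assms(2-)
proof (induction p arbitrary: x q)
  case Nil
  then show ?case by (cases q) (auto simp: awalk_simps)
next
  case (Cons e p)
  obtain f q' where q: "q = f # q'"
    using Cons.prems by (cases q) (auto simp: awalk_simps)
  have "e = f" using Cons.prems assms(1) by (auto simp: q awalk_simps inj_on_def)
  then show ?case using Cons.prems Cons.IH[of "head G f" q'] by (auto simp: q awalk_simps)
qed

text \<open>
  A recurrent arc closes up to a cycle through its tail, so two of them with a common tail would give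
  two cycles through one vertex. Conversely, a cycle is recovered from any of its vertices by always
  following the only recurrent arc. This reduces disjointness of cycles to a statement about single
  arcs, which is far easier to carry through a splitting than cycles modulo rotation.
\<close>

lemma (in wf_digraph) disjoint_cycles_iff_inj_on_recurrent_arcs:
  "disjoint_cycles G \<longleftrightarrow> inj_on (tail G) (recurrent_arcs G)"
proof
  assume *: "disjoint_cycles G"
  show "inj_on (tail G) (recurrent_arcs G)"
  proof (rule inj_onI)
    fix e f assume e: "e \<in> recurrent_arcs G" and f: "f \<in> recurrent_arcs G" and t: "tail G e = tail G f"
    obtain p where p: "cycle (e # p)" using e by (rule recurrent_arc_on_cycle)
    obtain q where q: "cycle (f # q)" using f by (rule recurrent_arc_on_cycle)
    let ?C = "\<lambda>p. range (\<lambda>k. rotate k p)"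
    have "?C (e # p) \<in> cycles_of G" "?C (f # q) \<in> cycles_of G"
      using p q by (auto simp: cycles_of_def)
    moreover have "tail G e \<in> cycle_verts G (?C (e # p))" "tail G e \<in> cycle_verts G (?C (f # q))"
      unfolding cycle_verts_rotations using t by auto
    moreover have "tail G e \<in> verts G" using e by (auto simp: recurrent_arcs_def)
    ultimately have "?C (e # p) = ?C (f # q)"
      using * unfolding disjoint_cycles_def by (blast dest: Uniq_D)
    moreover have "f # q \<in> ?C (f # q)" by (metis id_apply rangeI rotate0)
    ultimately obtain k where "f # q = rotate k (e # p)" by auto
    then have "f \<in> set (e # p)" by (metis list.set_intros(1) set_rotate)
    moreover have "distinct (map (tail G) (e # p))" using p by (elim cycleE)
    ultimately show "e = f" using t by auto
  qed
next
  assume inj: "inj_on (tail G) (recurrent_arcs G)"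
  show "disjoint_cycles G"
    unfolding disjoint_cycles_def
  proof (intro ballI Uniq_I, elim conjE)
    fix v C C' assume "C \<in> cycles_of G" "v \<in> cycle_verts G C" "C' \<in> cycles_of G" "v \<in> cycle_verts G C'"
    then obtain p q where p: "cycle p" "C = range (\<lambda>k. rotate k p)"
      and q: "cycle q" "C' = range (\<lambda>k. rotate k q)"
      and "v \<in> tail G ` set p" "v \<in> tail G ` set q"
      by (auto simp: cycles_of_def cycle_verts_rotations)
    then obtain e f where e: "e \<in> set p" "tail G e = v" and f: "f \<in> set q" "tail G f = v" by auto
    have sub: "set p \<subseteq> recurrent_arcs G" "set q \<subseteq> recurrent_arcs G"
      using p q by (auto dest: cycle_arcs_recurrent)
    have ef: "e = f" using inj sub e f by (auto simp: inj_on_def)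
    obtain p' where p': "awalk (head G e) p' v" "v \<notin> tail G ` set p'"
        "set (e # p') = set p" "C = range (\<lambda>k. rotate k (e # p'))"
      using cycle_at[OF p(1) e(1)] p(2) e(2) by metis
    obtain q' where q': "awalk (head G e) q' v" "v \<notin> tail G ` set q'"
        "set (e # q') = set q" "C' = range (\<lambda>k. rotate k (e # q'))"
      using cycle_at[OF q(1) f(1)] q(2) f(2) ef by metis
    have "set p' \<subseteq> recurrent_arcs G" "set q' \<subseteq> recurrent_arcs G"
      using sub by (metis p'(3) set_subset_Cons subset_trans, metis q'(3) set_subset_Cons subset_trans)
    then have "p' = q'"
      by (rule deterministic_awalk_unique[OF inj p'(1) q'(1) _ _ p'(2) q'(2)])
    then show "C = C'" using p' q' by simp
  qed
qed

lemma (in wf_digraph) cyclic_verts_iff: "v \<in> cyclic_verts G \<longleftrightarrow> (v, v) \<in> (arcs_ends G)\<^sup>+"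
proof
  assume "v \<in> cyclic_verts G"
  then obtain p e where p: "cycle p" "e \<in> set p" "tail G e = v"
    by (auto simp: cyclic_verts_def cycles_of_def cycle_verts_rotations)
  then have "e \<in> recurrent_arcs G" using cycle_arcs_recurrent by auto
  then show "(v, v) \<in> (arcs_ends G)\<^sup>+"
    using p(3) by (auto simp: recurrent_arcs_def intro: rtrancl_into_trancl2 in_arcs_ends)
next
  assume "(v, v) \<in> (arcs_ends G)\<^sup>+"
  then obtain w where w: "(v, w) \<in> arcs_ends G" "(w, v) \<in> (arcs_ends G)\<^sup>*" by (meson tranclD)
  then obtain e where e: "e \<in> recurrent_arcs G" "tail G e = v"
    by (auto simp: recurrent_arcs_def arcs_ends_conv)
  obtain p where "cycle (e # p)" using e(1) by (rule recurrent_arc_on_cycle)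
  then show "v \<in> cyclic_verts G"
    using e by (force simp: cyclic_verts_def cycles_of_def cycle_verts_rotations)
qed

text \<open>Every cyclic vertex is the tail and the head of a recurrent arc, hence counting turns
  injectivity of the tails into injectivity of the heads.\<close>

lemma (in fin_digraph) inj_on_head_recurrent_arcs:
  assumes "inj_on (tail G) (recurrent_arcs G)"
  shows "inj_on (head G) (recurrent_arcs G)"
proof -
  have fin: "finite (recurrent_arcs G)" by (simp add: recurrent_arcs_def)
  have "tail G ` recurrent_arcs G \<subseteq> head G ` recurrent_arcs G"
  proof clarify
    fix e assume "e \<in> recurrent_arcs G"
    then obtain p where p: "cycle (e # p)" by (rule recurrent_arc_on_cycle)
    then have "tail G e \<in> head G ` set (e # p)" by (elim cycleE) auto
    then show "tail G e \<in> head G ` recurrent_arcs G" using cycle_arcs_recurrent[OF p] by blast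
  qed
  then have "card (tail G ` recurrent_arcs G) \<le> card (head G ` recurrent_arcs G)"
    by (simp add: fin card_mono)
  then have "card (head G ` recurrent_arcs G) = card (recurrent_arcs G)"
    using card_image[OF assms] card_image_le[OF fin] by (metis le_antisym)
  then show ?thesis using fin by (rule eq_card_imp_inj_on[rotated])
qed

section \<open>Coverings and cycle transversals\<close>

text \<open>
  A splitting comes with a projection onto the original graph. For an in-splitting the projection
  maps the arcs leaving a vertex bijectively onto those leaving its image, so walks lift uniquely
  once their starting vertex has been lifted. What the argument needs to know about walks, cycles and
  out-degrees in an in-splitting follows from this alone, and isomorphisms have the same property.
\<close>

locale covering = H: fin_digraph H + G: fin_digraph G
  for H :: "('c, 'd) pre_digraph" and G :: "('a, 'b) pre_digraph"  +
  fixes f :: "'c \<Rightarrow> 'a" and g :: "'d \<Rightarrow> 'b"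
  assumes verts_in: "x \<in> verts H \<Longrightarrow> f x \<in> verts G"
    and head_hom: "e \<in> arcs H \<Longrightarrow> head G (g e) = f (head H e)"
    and out_arcs_bij: "x \<in> verts H \<Longrightarrow> bij_betw g (out_arcs H x) (out_arcs G (f x))"
begin

lemma arcs_in: "e \<in> arcs H \<Longrightarrow> g e \<in> arcs G"
  and tail_hom: "e \<in> arcs H \<Longrightarrow> tail G (g e) = f (tail H e)"
  using bij_betwE[OF out_arcs_bij, of "tail H e"] by auto

lemma inj_on_out_arcs:
  "\<lbrakk>d \<in> arcs H; e \<in> arcs H; tail H d = tail H e; g d = g e\<rbrakk> \<Longrightarrow> d = e"
  using bij_betw_imp_inj_on[OF out_arcs_bij, of "tail H d"] by (auto simp: inj_on_def)

lemma lift_arc: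
  assumes "x \<in> verts H" "e \<in> arcs G" "tail G e = f x"
  obtains e' where "e' \<in> arcs H" "tail H e' = x" "g e' = e"
proof -
  have "e \<in> g ` out_arcs H x"
    using bij_betw_imp_surj_on[OF out_arcs_bij[OF assms(1)]] assms(2,3) by simp
  then show thesis using that by auto
qed

lemma arcs_ends_hom: "(x, y) \<in> arcs_ends H \<Longrightarrow> (f x, f y) \<in> arcs_ends G"
  using in_arcs_ends[OF arcs_in] by (metis head_hom tail_hom reachableE)

lemma rtrancl_hom: "(x, y) \<in> (arcs_ends H)\<^sup>* \<Longrightarrow> (f x, f y) \<in> (arcs_ends G)\<^sup>*"
  by (induction rule: rtrancl_induct) (auto intro: rtrancl_into_rtrancl arcs_ends_hom)

lemma lift_rtrancl:
  assumes "(u, v) \<in> (arcs_ends G)\<^sup>*" "x \<in> verts H" "f x = u"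
  obtains y where "y \<in> verts H" "(x, y) \<in> (arcs_ends H)\<^sup>*" "f y = v"
  using assms(1)
proof (induction arbitrary: thesis rule: rtrancl_induct)
  case base
  then show ?case using assms by blast
next
  case (step v w)
  obtain y where y: "y \<in> verts H" "(x, y) \<in> (arcs_ends H)\<^sup>*" "f y = v" by (rule step.IH)
  obtain e where "e \<in> arcs G" "tail G e = v" "head G e = w"
    using step.hyps by (auto simp: arcs_ends_conv)
  then obtain e' where "e' \<in> arcs H" "tail H e' = y" "g e' = e"
    using lift_arc y by metis
  then show ?case
    using step.prems[of "head H e'"] y \<open>head G e = w\<close> in_arcs_ends[of e' H]
    by (auto simp: head_hom[symmetric] intro: rtrancl_into_rtrancl)
qed

lemma lift_trancl:
  assumes "(u, v) \<in> (arcs_ends G)\<^sup>+" "x \<in> verts H" "f x = u"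
  obtains y where "y \<in> verts H" "(x, y) \<in> (arcs_ends H)\<^sup>+" "f y = v"
proof -
  obtain w where "(u, w) \<in> (arcs_ends G)\<^sup>*" "(w, v) \<in> arcs_ends G"
    using assms(1) by (meson tranclD2)
  then obtain e where e: "e \<in> arcs G" "tail G e = w" "head G e = v"
    by (auto simp: arcs_ends_conv)
  obtain y where y: "y \<in> verts H" "(x, y) \<in> (arcs_ends H)\<^sup>*" "f y = w"
    using lift_rtrancl[OF \<open>(u, w) \<in> _\<close> assms(2,3)] .
  obtain e' where "e' \<in> arcs H" "tail H e' = y" "g e' = e"
    using lift_arc y e by metis
  then show thesis
    using that[of "head H e'"] y e in_arcs_ends[of e' H] 
    by (auto simp: head_hom[symmetric] intro: rtrancl_into_trancl1)
qed

lemma inj_on_recurrent_arcs: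
  assumes "inj_on (tail G) (recurrent_arcs G)"
  shows "inj_on (tail H) (recurrent_arcs H)"
proof (rule inj_onI)
  fix d e assume *: "d \<in> recurrent_arcs H" "e \<in> recurrent_arcs H" "tail H d = tail H e"
  then have "g d \<in> recurrent_arcs G" "g e \<in> recurrent_arcs G"
    using rtrancl_hom by (auto simp: recurrent_arcs_def arcs_in head_hom tail_hom)
  moreover have "tail G (g d) = tail G (g e)"
    using * by (auto simp: recurrent_arcs_def tail_hom)
  ultimately have "g d = g e" using assms by (simp add: inj_on_def)
  then show "d = e" using * inj_on_out_arcs by (auto simp: recurrent_arcs_def)
qed

end

text \<open>
  A function increasing along all arcs that avoid \<open>D\<close> shows that every cycle meets \<open>D\<close>. Later it also
  gives the order in which the vertices outside \<open>D\<close> become thin.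
\<close>

definition ranked_off :: "('a, 'b) pre_digraph \<Rightarrow> 'a set \<Rightarrow> ('a \<Rightarrow> nat) \<Rightarrow> bool" where
  "ranked_off G D l \<longleftrightarrow>
     (\<forall>e\<in>arcs G. tail G e \<notin> D \<and> head G e \<notin> D \<longrightarrow> l (tail G e) < l (head G e))"

text \<open>
  When cycles are disjoint, this is a choice of one vertex on each cycle: distinct elements of \<open>D\<close> are
  not mutually reachable, hence lie on distinct cycles, and the rank function prevents a cycle from
  avoiding \<open>D\<close>.
\<close>

definition cycle_transversal :: "('a, 'b) pre_digraph \<Rightarrow> 'a set \<Rightarrow> bool" where
  "cycle_transversal G D \<longleftrightarrow> D \<subseteq> verts G \<and>
     (\<forall>d\<in>D. (d, d) \<in> (arcs_ends G)\<^sup>+) \<and>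
     (\<forall>d\<in>D. \<forall>d'\<in>D. (d, d') \<in> (arcs_ends G)\<^sup>* \<and> (d', d) \<in> (arcs_ends G)\<^sup>* \<longrightarrow> d = d') \<and>
     (\<exists>l. ranked_off G D l)"

text \<open>
  One cyclic vertex is chosen from each strong component. Consider a closed walk avoiding the chosen
  vertices, and a path from one of its vertices to the chosen vertex of the same component. All arcs
  of the path are recurrent, as are those of the closed walk; since recurrent arcs are determined by
  their tails, the path never leaves the walk, a contradiction. So the arcs avoiding the chosen
  vertices form an acyclic relation, and counting predecessors ranks it.
\<close>

lemma (in fin_digraph) cycle_transversal_exists:
  assumes inj: "inj_on (tail G) (recurrent_arcs G)"
  obtains D where "cycle_transversal G D"
proof -
  let ?A = "arcs_ends G"
  define scc where "scc v = {u. (u, v) \<in> ?A\<^sup>* \<and> (v, u) \<in> ?A\<^sup>*}" for v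
  define D where "D = {v. (v, v) \<in> ?A\<^sup>+ \<and> v = (SOME u. u \<in> scc v)}"
  have scc_eq: "scc u = scc v" if "u \<in> scc v" for u v
    using that unfolding scc_def by (blast intro: rtrancl_trans)
  have D_verts: "D \<subseteq> verts G"
    using reachable1_in_verts by (auto simp: D_def)
  have D_uniq: "d = d'" if "d \<in> D" "d' \<in> D" "(d, d') \<in> ?A\<^sup>*" "(d', d) \<in> ?A\<^sup>*" for d d'
  proof -
    have "scc d = scc d'" using scc_eq[of d d'] that by (auto simp: scc_def)
    then show ?thesis using that(1,2) by (simp add: D_def)
  qed
  have D_hit: "\<exists>d\<in>D. d \<in> scc v" if "(v, v) \<in> ?A\<^sup>+" for v
  proof -
    define d where "d = (SOME u. u \<in> scc v)"
    have "v \<in> scc v" by (simp add: scc_def)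
    then have d: "d \<in> scc v" unfolding d_def by (rule someI)
    then have "(d, d) \<in> ?A\<^sup>+"
      using that unfolding scc_def by (metis (mono_tags, lifting) mem_Collect_eq
        rtrancl_trancl_trancl trancl_rtrancl_trancl)
    moreover have "d = (SOME u. u \<in> scc d)" using scc_eq[OF d] by (simp add: d_def)
    ultimately show ?thesis using d by (auto simp: D_def)
  qed
  define B where "B = {(tail G e, head G e) |e. e \<in> arcs G \<and> tail G e \<notin> D \<and> head G e \<notin> D}"
  have BA: "B \<subseteq> ?A" by (auto simp: B_def in_arcs_ends)
  have "acyclic B"
    unfolding acyclic_def
  proof (intro allI notI)
    fix x assume x: "(x, x) \<in> B\<^sup>+"
    then have "(x, x) \<in> ?A\<^sup>+" using BA by (metis trancl_mono)
    then obtain d where d: "d \<in> D" "(d, x) \<in> ?A\<^sup>*" "(x, d) \<in> ?A\<^sup>*"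
      using D_hit by (auto simp: scc_def)
    from d(3) d(2) x have "(d, d) \<in> B\<^sup>+"
    proof (induction rule: converse_rtrancl_induct)
      case (step x y)
      obtain e where e: "e \<in> arcs G" "tail G e = x" "head G e = y"
        using step.hyps by (auto simp: arcs_ends_conv)
      obtain z where z: "(x, z) \<in> B" "(z, x) \<in> B\<^sup>*" using step.prems by (meson tranclD)
      then obtain h where h: "h \<in> arcs G" "tail G h = x" "head G h = z" by (auto simp: B_def)
      have "e \<in> recurrent_arcs G"
        using e step.hyps step.prems(1) by (auto simp: recurrent_arcs_def)
      moreover have "h \<in> recurrent_arcs G"
        using h rtrancl_mono[OF BA] z(2) unfolding recurrent_arcs_def by blast
      ultimately have "y = z" using inj e h by (auto simp: inj_on_def)
      then have "(y, y) \<in> B\<^sup>+" using z by auto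
      moreover have "(d, y) \<in> ?A\<^sup>*" using step by auto
      ultimately show ?case using step.IH by blast
    qed
    then obtain z where "(d, z) \<in> B" by (meson tranclD)
    then show False using d by (auto simp: B_def)
  qed
  have "finite B" by (rule finite_subset[of _ "?A"]) (use BA in \<open>auto simp: arcs_ends_def\<close>)
  define l where "l v = card {u. (u, v) \<in> B\<^sup>+}" for v
  have "l x < l y" if xy: "(x, y) \<in> B" for x y
    unfolding l_def
  proof (rule psubset_card_mono)
    have "{u. (u, y) \<in> B\<^sup>+} \<subseteq> Domain (B\<^sup>+)" by blast
    then show "finite {u. (u, y) \<in> B\<^sup>+}"
      using \<open>finite B\<close> by (meson finite_Domain finite_subset finite_trancl)
    have "x \<in> {u. (u, y) \<in> B\<^sup>+}" using xy by simp
    moreover have "x \<notin> {u. (u, x) \<in> B\<^sup>+}" using \<open>acyclic B\<close> by (simp add: acyclic_def)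
    moreover have "{u. (u, x) \<in> B\<^sup>+} \<subseteq> {u. (u, y) \<in> B\<^sup>+}"
      using xy by (meson Collect_mono trancl_into_trancl)
    ultimately show "{u. (u, x) \<in> B\<^sup>+} \<subset> {u. (u, y) \<in> B\<^sup>+}" by blast
  qed
  then have "ranked_off G D l" by (auto simp: ranked_off_def B_def)
  moreover have "\<forall>d\<in>D. (d, d) \<in> ?A\<^sup>+" by (simp add: D_def)
  ultimately have "cycle_transversal G D"
    using D_verts D_uniq unfolding cycle_transversal_def by blast
  then show thesis by (rule that)
qed

text \<open>
  Vertices that are sinks (for \<open>in_thin\<close>) or sources (for \<open>out_thin\<close>) are exempt: they are interior to no
  trail, and splitting them could disconnect the graph.
\<close>

definition in_thin :: "('a, 'b) pre_digraph \<Rightarrow> 'a set \<Rightarrow> bool" where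
  "in_thin G D \<longleftrightarrow> (\<forall>v\<in>verts G - D. out_arcs G v \<noteq> {} \<longrightarrow> card (in_arcs G v) \<le> 1)"

definition out_thin :: "('a, 'b) pre_digraph \<Rightarrow> 'a set \<Rightarrow> bool" where
  "out_thin G D \<longleftrightarrow> (\<forall>v\<in>verts G - D. in_arcs G v \<noteq> {} \<longrightarrow> card (out_arcs G v) \<le> 1)"

context covering
begin

abbreviation lift :: "'a set \<Rightarrow> 'c set" where
  "lift D \<equiv> {x \<in> verts H. f x \<in> D}"

lemma ranked_off_lift: "ranked_off G D l \<Longrightarrow> ranked_off H (lift D) (l \<circ> f)"
  by (auto simp: ranked_off_def arcs_in head_hom[symmetric] tail_hom[symmetric])

text \<open>
  A closed walk at a point of \<open>D\<close> lifts to a walk with both ends in one fibre. Over \<open>D\<close> the fibres are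
  single points, so the lifted walk is closed again.
\<close>

lemma cycle_transversal_lift:
  assumes D: "cycle_transversal G D" and inj: "inj_on f (lift D)"
  shows "cycle_transversal H (lift D)"
proof -
  have "(x, x) \<in> (arcs_ends H)\<^sup>+" if x: "x \<in> lift D" for x
  proof -
    have "(f x, f x) \<in> (arcs_ends G)\<^sup>+" using D x by (auto simp: cycle_transversal_def)
    moreover have "x \<in> verts H" using x by simp
    ultimately obtain y where y: "y \<in> verts H" "(x, y) \<in> (arcs_ends H)\<^sup>+" "f y = f x"
      using lift_trancl[OF _ _ refl] by metis
    have "y = x" using inj by (rule inj_onD) (use x y in auto)
    then show ?thesis using y by simp
  qed
  moreover have "x = y" if "x \<in> lift D" "y \<in> lift D"
      "(x, y) \<in> (arcs_ends H)\<^sup>*" "(y, x) \<in> (arcs_ends H)\<^sup>*" for x y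
  proof -
    have "(f x, f y) \<in> (arcs_ends G)\<^sup>*" "(f y, f x) \<in> (arcs_ends G)\<^sup>*"
      using that rtrancl_hom by blast+
    then have "f x = f y" using D that(1,2) unfolding cycle_transversal_def by blast
    then show ?thesis using that(1,2) by (rule inj_onD[OF inj])
  qed
  moreover have "\<exists>l. ranked_off H (lift D) l"
    using D ranked_off_lift unfolding cycle_transversal_def by blast
  ultimately show ?thesis unfolding cycle_transversal_def by blast
qed

lemma out_thin_lift:
  assumes "out_thin G D"
  shows "out_thin H (lift D)"
  unfolding out_thin_def
proof (intro ballI impI)
  fix x assume x: "x \<in> verts H - lift D" "in_arcs H x \<noteq> {}"
  then obtain e where "e \<in> in_arcs H x" by blast
  then have "e \<in> arcs H" "head H e = x" by auto
  then have "g e \<in> in_arcs G (f x)" by (simp add: arcs_in head_hom)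
  then have "in_arcs G (f x) \<noteq> {}" by blast
  then have "card (out_arcs G (f x)) \<le> 1" 
    using assms x(1) verts_in[of x] by (simp add: out_thin_def)
  then show "card (out_arcs H x) \<le> 1"
    using x(1) bij_betw_same_card[OF out_arcs_bij, of x] by simp
qed

end

section \<open>In-splittings as coverings\<close>

text \<open>
  By this the definite description in \<open>in_split_graph\<close> denotes the class containing the arc.
\<close>

lemma in_class_unique:
  assumes "wf_digraph G" "in_splitting_data G m P" "e \<in> arcs G"
  shows "\<exists>!i. i \<in> {1..m (head G e)} \<and> e \<in> P (head G e) i"
proof -
  let ?v = "head G e"
  have v: "?v \<in> verts G" using assms(1,3) by (rule wf_digraph.head_in_verts)
  have e: "e \<in> in_arcs G ?v" using assms(3) by simp
  have ne: "in_arcs G ?v \<noteq> {}" using e by blast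
  have *: "partition_on (in_arcs G ?v) (P ?v ` {1..m ?v}) \<and> inj_on (P ?v) {1..m ?v}"
    using bspec[OF assms(2)[unfolded in_splitting_data_def] v] unfolding if_not_P[OF ne] .
  note part = conjunct1[OF *] and inj = conjunct2[OF *]
  have "e \<in> \<Union> (P ?v ` {1..m ?v})" using part e by (simp only: partition_on_def)
  then obtain i where i: "i \<in> {1..m ?v}" "e \<in> P ?v i" by (elim UN_E)
  have uniq: "j = i" if j: "j \<in> {1..m ?v}" "e \<in> P ?v j" for j
  proof (rule inj_onD[OF inj])
    have "P ?v j \<inter> P ?v i \<noteq> {}" using j(2) i(2) by blast
    then show "P ?v j = P ?v i"
      using disjointD[OF partition_onD2[OF part] imageI[OF j(1)] imageI[OF i(1)]] by blast
  qed (use i j in simp_all)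
  show ?thesis
  proof (rule ex1I[of _ i])
    show "i \<in> {1..m ?v} \<and> e \<in> P ?v i" using i by (rule conjI)
    show "j = i" if "j \<in> {1..m ?v} \<and> e \<in> P ?v j" for j
      using that by (elim conjE) (rule uniq)
  qed
qed

lemma head_in_split_graph:
  assumes "wf_digraph G" "in_splitting_data G m P" "e \<in> arcs G"
  obtains i where "i \<in> {1..m (head G e)}" "e \<in> P (head G e) i"
    "\<And>j. head (in_split_graph G m P) (e, j) = (head G e, i)"
proof -
  define i where "i = (THE i. i \<in> {1..m (head G e)} \<and> e \<in> P (head G e) i)"
  have "i \<in> {1..m (head G e)} \<and> e \<in> P (head G e) i"
    unfolding i_def by (rule theI') (rule in_class_unique[OF assms])
  moreover have "head (in_split_graph G m P) (e, j) = (head G e, i)" for j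
    by (simp add: in_split_graph_def i_def)
  ultimately show thesis using that by blast
qed

lemma in_split_graph_simps:
  "verts (in_split_graph G m P) = (SIGMA v:verts G. {1..m v})"
  "arcs (in_split_graph G m P) = (SIGMA e:arcs G. {1..m (tail G e)})"
  "tail (in_split_graph G m P) (e, j) = (tail G e, j)"
  by (auto simp: in_split_graph_def)

lemma fin_digraph_in_split_graph:
  assumes "fin_digraph G" "in_splitting_data G m P"
  shows "fin_digraph (in_split_graph G m P)"
proof -
  interpret fin_digraph G by fact
  show ?thesis
  proof unfold_locales
    fix x assume "x \<in> arcs (in_split_graph G m P)"
    then obtain e j where x: "x = (e, j)" "e \<in> arcs G" "j \<in> {1..m (tail G e)}"
      by (auto simp: in_split_graph_simps)
    then show "tail (in_split_graph G m P) x \<in> verts (in_split_graph G m P)"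
      by (simp add: in_split_graph_simps)
    show "head (in_split_graph G m P) x \<in> verts (in_split_graph G m P)"
      using head_in_split_graph[OF wf_digraph assms(2) x(2)] x
      by (metis head_in_verts in_split_graph_simps(1) mem_Sigma_iff)
  qed (auto simp: in_split_graph_simps)
qed

lemma covering_in_split_graph:
  assumes "fin_digraph G" "in_splitting_data G m P"
  shows "covering (in_split_graph G m P) G fst fst"
proof -
  interpret fin_digraph G by fact
  interpret S: fin_digraph "in_split_graph G m P" by (rule fin_digraph_in_split_graph) fact+
  show ?thesis
  proof unfold_locales
    fix x assume "x \<in> arcs (in_split_graph G m P)"
    then show "head G (fst x) = fst (head (in_split_graph G m P) x)"
      by (auto simp: in_split_graph_def)
  next
    fix x assume "x \<in> verts (in_split_graph G m P)"
    then show "bij_betw fst (out_arcs (in_split_graph G m P) x) (out_arcs G (fst x))"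
      by (intro bij_betw_byWitness[where f' = "\<lambda>e. (e, snd x)"])
        (auto simp: in_split_graph_simps out_arcs_def)
  next
    fix x assume "x \<in> verts (in_split_graph G m P)"
    then show "fst x \<in> verts G" by (auto simp: in_split_graph_simps)
  qed
qed

text \<open>
  Copies of one vertex are joined through the common head of the copies of an arc leaving it; hence
  only copies of a sink could be torn apart.
\<close>

lemma connected_in_split_graph:
  assumes "fin_digraph G" "in_splitting_data G m P" "Digraph_Component.connected G"
    and sink: "\<And>v. \<lbrakk>v \<in> verts G; out_arcs G v = {}\<rbrakk> \<Longrightarrow> m v = 1"
  shows "Digraph_Component.connected (in_split_graph G m P)"
proof -
  interpret fin_digraph G by fact
  let ?S = "in_split_graph G m P"
  interpret S: fin_digraph ?S by (rule fin_digraph_in_split_graph) fact+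
  let ?R = "rtrancl_on (verts ?S) ((arcs_ends ?S)\<^sup>s)"
  have sym: "(y, x) \<in> ?R" if "(x, y) \<in> ?R" for x y
  proof -
    have "sym ((arcs_ends ?S)\<^sup>s)" by (rule symI) (auto simp: symcl_def)
    then show ?thesis using that rtrancl_on_sym by (meson symD)
  qed
  have arc: "(tail ?S x, head ?S x) \<in> ?R" if "x \<in> arcs ?S" for x
  proof (rule rtrancl_on_into_rtrancl_on[OF rtrancl_on_refl])
    show "(tail ?S x, head ?S x) \<in> (arcs_ends ?S)\<^sup>s"
      using in_arcs_ends[OF that] by (simp add: symcl_def)
  qed (use that in simp_all)
  have copies: "((v, i), (v, j)) \<in> ?R" if "v \<in> verts G" "i \<in> {1..m v}" "j \<in> {1..m v}" for v i j
  proof (cases "out_arcs G v = {}")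
    case True
    then show ?thesis using that sink[of v] by (auto simp: in_split_graph_simps)
  next
    case False
    then obtain e where "e \<in> out_arcs G v" by blast
    then have e: "e \<in> arcs G" "tail G e = v" by simp_all
    then obtain k where k: "\<And>j. head ?S (e, j) = (head G e, k)"
      using head_in_split_graph[OF wf_digraph assms(2)] by metis
    have "((v, i), head ?S (e, i)) \<in> ?R" "((v, j), head ?S (e, j)) \<in> ?R"
      using arc[of "(e, i)"] arc[of "(e, j)"] e that by (auto simp: in_split_graph_simps)
    then show ?thesis unfolding k using sym rtrancl_on_trans by metis
  qed
  have m1: "m v \<ge> 1" if "v \<in> verts G" for v
  proof (cases "in_arcs G v = {}")
    case False
    then obtain e where "e \<in> in_arcs G v" by blast
    then obtain i where "i \<in> {1..m v}"
      using in_class_unique[OF wf_digraph assms(2), of e] by auto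
    then show ?thesis by simp
  qed (use assms(2) that in \<open>auto simp: in_splitting_data_def\<close>)
  have arc_step: "((u, i), (v, j)) \<in> ?R"
    if e: "e \<in> arcs G" "tail G e = u" "head G e = v" and i: "i \<in> {1..m u}" and j: "j \<in> {1..m v}"
    for e u v i j
  proof -
    obtain k where k: "k \<in> {1..m v}" "head ?S (e, i) = (v, k)"
      using head_in_split_graph[OF wf_digraph assms(2)] e by metis
    have "((u, i), (v, k)) \<in> ?R"
      using arc[of "(e, i)"] e i k by (auto simp: in_split_graph_simps)
    moreover have "((v, k), (v, j)) \<in> ?R" using copies k j e by auto
    ultimately show ?thesis by (rule rtrancl_on_trans)
  qed
  have walk: "((u, i), (v, j)) \<in> ?R"
    if "(u, v) \<in> rtrancl_on (verts G) ((arcs_ends G)\<^sup>s)" "i \<in> {1..m u}" "j \<in> {1..m v}" for u v i j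
    using that
  proof (induction arbitrary: j rule: rtrancl_on_induct)
    case (step v w)
    have "((v, 1), (w, j)) \<in> ?R"
    proof -
      have 1: "1 \<in> {1..m v}" using m1[OF step.hyps(3)] by simp
      obtain e where "e \<in> arcs G" "tail G e = v \<and> head G e = w \<or> tail G e = w \<and> head G e = v"
        using step.hyps(2) by (auto simp: symcl_def arcs_ends_conv)
      then show ?thesis using arc_step[OF _ _ _ 1 step.prems(2)] 
        sym[OF arc_step[OF _ _ _ step.prems(2) 1]] by blast
    qed
    moreover have "((u, i), (v, 1)) \<in> ?R"
      using step.IH step.prems(1) m1[OF step.hyps(3)] by simp
    ultimately show ?case by (rule rtrancl_on_trans[rotated])
  qed (use copies in blast)
  show ?thesis
    unfolding connected_conv
  proof (intro conjI ballI)
    obtain v where "v \<in> verts G" using assms(3) by (auto simp: connected_conv)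
    then have "(v, 1) \<in> verts ?S" using m1 by (auto simp: in_split_graph_simps)
    then show "verts ?S \<noteq> {}" by auto
  next
    fix x y assume "x \<in> verts ?S" "y \<in> verts ?S"
    then show "(x, y) \<in> ?R"
      using walk assms(3) by (auto simp: connected_conv in_split_graph_simps)
  qed
qed

lemma nat_graph_isomorphic:
  fixes S :: "('a, 'b) pre_digraph"
  assumes "fin_digraph S"
  obtains F :: "(nat, nat) pre_digraph" and f g where
    "digraph_iso S F" "fin_digraph F"
    "Digraph_Component.connected S \<longrightarrow> Digraph_Component.connected F"
    "covering F S f g" "inj_on f (verts F)"
    "\<forall>x\<in>verts F. card (in_arcs F x) = card (in_arcs S (f x))"
proof -
  interpret S: fin_digraph S by fact
  obtain \<phi> :: "'a \<Rightarrow> nat" where \<phi>: "inj_on \<phi> (verts S)"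
    using finite_imp_inj_to_nat_seg[OF S.finite_verts] by metis
  obtain \<psi> :: "'b \<Rightarrow> nat" where \<psi>: "inj_on \<psi> (arcs S)"
    using finite_imp_inj_to_nat_seg[OF S.finite_arcs] by metis
  define h where "h = \<lparr>iso_verts = \<phi>, iso_arcs = \<psi>,
    iso_head = (\<lambda>e. \<phi> (head S (the_inv_into (arcs S) \<psi> e))),
    iso_tail = (\<lambda>e. \<phi> (tail S (the_inv_into (arcs S) \<psi> e)))\<rparr>"
  have h: "S.digraph_isomorphism h"
    using \<phi> \<psi> by (auto simp: S.digraph_isomorphism_def h_def the_inv_into_f_f S.wf_digraph)
  define F where "F = app_iso h S"
  interpret F: fin_digraph F unfolding F_def using h by (rule S.fin_digraphI_app_iso)
  \<comment> \<open>the covering projects the relabelled graph back onto \<open>S\<close>\<close>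
  define h' where "h' = S.inv_iso h"
  have h': "F.digraph_isomorphism h'"
    unfolding F_def h'_def using h by (rule S.digraph_isomorphism_invI)
  have S_eq: "S = app_iso h' F"
    unfolding F_def h'_def using h by (simp add: S.app_iso_inv)
  show thesis
  proof
    show "digraph_iso S F" using h by (auto simp: digraph_iso_def F_def)
    show "fin_digraph F" by (rule F.fin_digraph)
    show "Digraph_Component.connected S \<longrightarrow> Digraph_Component.connected F"
      unfolding F_def using S.connectedI_app_iso[OF _ h] by (rule impI)
    show "inj_on (iso_verts h') (verts F)" using h' by (rule F.digraph_isomorphism_inj_on_verts)
    show "\<forall>x\<in>verts F. card (in_arcs F x) = card (in_arcs S (iso_verts h' x))"
      using F.in_degree_app_iso_eq[OF h'] unfolding in_degree_def S_eq[symmetric] by simp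
    show "covering F S (iso_verts h') (iso_arcs h')"
    proof (intro covering.intro covering_axioms.intro F.fin_digraph assms)
      fix x assume x: "x \<in> verts F"
      then show "iso_verts h' x \<in> verts S" by (subst S_eq) simp
      have "out_arcs S (iso_verts h' x) = iso_arcs h' ` out_arcs F x"
        by (subst S_eq) (rule F.out_arcs_app_iso_eq[OF h' x])
      moreover have "inj_on (iso_arcs h') (out_arcs F x)"
        using F.digraph_isomorphism_inj_on_arcs[OF h'] by (rule inj_on_subset) auto
      ultimately show "bij_betw (iso_arcs h') (out_arcs F x) (out_arcs S (iso_verts h' x))"
        by (simp add: bij_betw_def)
    next
      fix e assume "e \<in> arcs F"
      then show "head S (iso_arcs h' e) = iso_verts h' (head F e)"
        by (subst S_eq) (simp add: F.iso_verts_head[OF h'])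
    qed
  qed
qed

lemma covering_comp:
  assumes "covering H G f g" "covering K H f' g'"
  shows "covering K G (f \<circ> f') (g \<circ> g')"
proof -
  interpret G: covering H G f g by fact
  interpret H: covering K H f' g' by fact
  show ?thesis
  proof unfold_locales
    show "bij_betw (g \<circ> g') (out_arcs K x) (out_arcs G ((f \<circ> f') x))" if "x \<in> verts K" for x
      using H.out_arcs_bij[OF that] G.out_arcs_bij[OF H.verts_in[OF that]]
      by (simp add: bij_betw_trans)
  qed (simp_all add: G.verts_in H.verts_in G.head_hom H.head_hom H.arcs_in)
qed

section \<open>Thinning a graph by splittings\<close>

definition in_thin_below :: "('a, 'b) pre_digraph \<Rightarrow> 'a set \<Rightarrow> ('a \<Rightarrow> nat) \<Rightarrow> nat \<Rightarrow> bool" where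
  "in_thin_below G D l k \<longleftrightarrow>
     (\<forall>v\<in>verts G - D. out_arcs G v \<noteq> {} \<and> l v < k \<longrightarrow> card (in_arcs G v) \<le> 1)"

lemma partition_on_singletons: "partition_on A ((\<lambda>a. {a}) ` A)"
  by (rule partition_onI) auto

text \<open>
  All vertices outside \<open>D\<close> that are neither sinks nor sources are split at once, one class per incoming
  arc. The in-degree of a copy of \<open>v\<close> is then the number of copies of the tail of a single arc. That
  tail either lies in \<open>D\<close> and is left alone, or it has smaller rank than \<open>v\<close> and, being thin already, also
  has one copy only. Thus thinness advances by one rank.
\<close>

lemma thinning_in_splitting:
  fixes G :: "('a, 'b) pre_digraph"
  assumes "fin_digraph G" "Digraph_Component.connected G"
    and rank: "ranked_off G D l" and thin: "in_thin_below G D l k"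
  obtains F :: "(nat, nat) pre_digraph" and f g where
    "in_splitting G F" "Digraph_Component.connected F" "covering F G f g"
    "inj_on f {x \<in> verts F. f x \<in> D}"
    "in_thin_below F {x \<in> verts F. f x \<in> D} (l \<circ> f) (Suc k)"
proof -
  interpret fin_digraph G by fact
  define split where "split v \<longleftrightarrow> v \<notin> D \<and> out_arcs G v \<noteq> {} \<and> in_arcs G v \<noteq> {}" for v
  have "\<exists>b. bij_betw b {1..card (in_arcs G v)} (in_arcs G v)" for v
    by (rule ex_bij_betw_nat_finite_1) (simp add: in_arcs_def)
  then obtain b where b: "bij_betw (b v) {1..card (in_arcs G v)} (in_arcs G v)" for v
    by metis
  define m where "m v = (if split v then card (in_arcs G v) else 1)" for v
  define P where "P v i = (if split v then {b v i} else in_arcs G v)" for v i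
  have data: "in_splitting_data G m P"
    unfolding in_splitting_data_def
  proof (intro ballI)
    fix v
    have "partition_on (in_arcs G v) (P v ` {1..m v}) \<and> inj_on (P v) {1..m v}"
      if ne: "in_arcs G v \<noteq> {}"
    proof (cases "split v")
      case True
      have "P v ` {1..m v} = (\<lambda>a. {a}) ` b v ` {1..card (in_arcs G v)}"
        by (simp add: P_def m_def True image_image)
      also have "b v ` {1..card (in_arcs G v)} = in_arcs G v"
        using b by (rule bij_betw_imp_surj_on)
      finally have "partition_on (in_arcs G v) (P v ` {1..m v})"
        by (simp only: partition_on_singletons)
      moreover have "inj_on (P v) {1..m v}"
      proof (rule inj_onI)
        fix i j assume "i \<in> {1..m v}" "j \<in> {1..m v}" "P v i = P v j"
        then show "i = j"
          using inj_onD[OF bij_betw_imp_inj_on[OF b[of v]], of i j] by (simp add: P_def m_def True)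
      qed
      ultimately show ?thesis ..
    next
      case False
      then have "P v ` {1..m v} = {in_arcs G v}" by (auto simp: P_def m_def)
      then show ?thesis using ne partition_on_space[OF ne] by (simp add: m_def False)
    qed
    then show "if in_arcs G v = {} then m v = 1
        else partition_on (in_arcs G v) (P v ` {1..m v}) \<and> inj_on (P v) {1..m v}"
      by (simp add: m_def split_def)
  qed
  let ?S = "in_split_graph G m P"
  have finS: "fin_digraph ?S" by (rule fin_digraph_in_split_graph) (fact fin_digraph data)+
  interpret S: covering ?S G fst fst by (rule covering_in_split_graph) (fact fin_digraph data)+
  have conn: "Digraph_Component.connected ?S"
    by (rule connected_in_split_graph) (fact fin_digraph data assms(2) | simp add: m_def split_def)+
  have thin_S: "card (in_arcs ?S (v, i)) \<le> 1"
    if v: "v \<in> verts G" "v \<notin> D" "out_arcs G v \<noteq> {}" "l v < Suc k" for v i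
  proof -
    \<comment> \<open>the second components are forced because the tail of the arc \<open>b v i\<close> has one copy only\<close>
    have char: "e = b v i \<and> j = 1" if x: "(e, j) \<in> in_arcs ?S (v, i)" for e j
    proof -
      have e: "e \<in> arcs G" "j \<in> {1..m (tail G e)}" and "head ?S (e, j) = (v, i)"
        using x by (simp_all add: in_split_graph_simps)
      moreover obtain i' where "e \<in> P (head G e) i'" "head ?S (e, j) = (head G e, i')"
        using head_in_split_graph[OF wf_digraph data e(1)] by blast
      ultimately have h: "head G e = v" "e \<in> P v i" by simp_all
      then have "split v" using v e by (auto simp: split_def)
      then have "e = b v i" using h by (simp add: P_def)
      moreover have "m (tail G e) \<le> 1"
      proof (cases "split (tail G e)")
        case True
        then have "tail G e \<notin> D" by (simp add: split_def)
        then have "l (tail G e) < l v" using rank e h v by (auto simp: ranked_off_def)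
        then have "card (in_arcs G (tail G e)) \<le> 1"
          using thin v(4) e True by (simp add: in_thin_below_def split_def)
        then show ?thesis by (simp add: m_def)
      qed (simp add: m_def)
      ultimately show ?thesis using e by simp
    qed
    have "finite (in_arcs ?S (v, i))" by (simp add: in_arcs_def)
    moreover have "x = y" if "x \<in> in_arcs ?S (v, i)" "y \<in> in_arcs ?S (v, i)" for x y
      using char[of "fst x" "snd x"] char[of "fst y" "snd y"] that by (simp add: prod_eq_iff)
    ultimately show ?thesis by (simp add: card_le_Suc0_iff_eq)
  qed
  obtain F :: "(nat, nat) pre_digraph" and f g where F: "digraph_iso ?S F" "fin_digraph F"
    "Digraph_Component.connected ?S \<longrightarrow> Digraph_Component.connected F"
    "covering F ?S f g" "inj_on f (verts F)"
    "\<forall>x\<in>verts F. card (in_arcs F x) = card (in_arcs ?S (f x))"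
    by (rule nat_graph_isomorphic[OF finS])
  interpret F: covering F ?S f g by (rule F(4))
  show thesis
  proof
    show "in_splitting G F" using data F(1) unfolding in_splitting_def by blast
    show "Digraph_Component.connected F" using F(3) conn by blast
    show "covering F G (fst \<circ> f) (fst \<circ> g)"
      by (rule covering_comp) (rule S.covering_axioms, rule F.covering_axioms)
    then interpret FG: covering F G "fst \<circ> f" "fst \<circ> g" .
    show "inj_on (fst \<circ> f) {x \<in> verts F. (fst \<circ> f) x \<in> D}"
    proof (rule inj_onI)
      fix x y assume x: "x \<in> {x \<in> verts F. (fst \<circ> f) x \<in> D}"
        and y: "y \<in> {x \<in> verts F. (fst \<circ> f) x \<in> D}" and eq: "(fst \<circ> f) x = (fst \<circ> f) y"
      have 1: "snd (f z) = 1" if "z \<in> verts F" "fst (f z) \<in> D" for z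
        using F.verts_in[OF that(1)] that(2)
        by (cases "f z") (simp add: in_split_graph_simps m_def split_def)
      have "f x = f y" using 1[of x] 1[of y] x y eq by (simp add: prod_eq_iff)
      then show "x = y" using F(5) x y by (simp add: inj_on_def)
    qed
    show "in_thin_below F {x \<in> verts F. (fst \<circ> f) x \<in> D} (l \<circ> (fst \<circ> f)) (Suc k)"
      unfolding in_thin_below_def
    proof (intro ballI impI, elim conjE)
      fix x assume x: "x \<in> verts F - {x \<in> verts F. (fst \<circ> f) x \<in> D}"
        and out: "out_arcs F x \<noteq> {}" and lx: "(l \<circ> (fst \<circ> f)) x < Suc k"
      obtain v i where fx: "f x = (v, i)" by (cases "f x")
      have "v \<in> verts G" "v \<notin> D" using x FG.verts_in[of x] by (simp_all add: fx)
      moreover have "out_arcs G v \<noteq> {}"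
        using FG.out_arcs_bij[of x] x out by (auto simp: fx bij_betw_def)
      ultimately have "card (in_arcs ?S (v, i)) \<le> 1"
        using lx by (intro thin_S) (simp_all add: fx)
      then show "card (in_arcs F x) \<le> 1" using bspec[OF F(6), of x] x by (simp add: fx)
    qed
  qed
qed

text \<open>
  The properties that hold from the first renaming on and survive every move of the construction.
\<close>

definition prepared :: "('a, 'b) pre_digraph \<Rightarrow> 'a set \<Rightarrow> bool" where
  "prepared G D \<longleftrightarrow> fin_digraph G \<and> Digraph_Component.connected G \<and>
     inj_on (tail G) (recurrent_arcs G) \<and> cycle_transversal G D"

text \<open>
  The projections of the successive splittings pull the rank back to a rank with the same bound, so
  finitely many rounds suffice. Bijectivity on outgoing arcs keeps \<open>out_thin\<close> along the way.
\<close>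

lemma thinning_in_splittings:
  fixes G :: "(nat, nat) pre_digraph"
  assumes G: "prepared G D"
  obtains F D' where "in_splitting\<^sup>*\<^sup>* G F" "prepared F D'" "in_thin F D'"
    "out_thin G D \<longrightarrow> out_thin F D'"
proof -
  obtain l where l: "ranked_off G D l" using G unfolding prepared_def cycle_transversal_def by blast
  have "finite (verts G)" using G by (simp add: prepared_def fin_digraph.finite_verts)
  then have bound: "\<forall>v\<in>verts G. l v < Suc (Max (l ` verts G))" by (simp add: le_imp_less_Suc)
  have "\<exists>F D' l'. in_splitting\<^sup>*\<^sup>* G F \<and> prepared F D' \<and> (out_thin G D \<longrightarrow> out_thin F D') \<and>
      ranked_off F D' l' \<and> (\<forall>v\<in>verts F. l' v < N) \<and> in_thin_below F D' l' k"
    if N: "\<forall>v\<in>verts G. l v < N" for k N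
  proof (induction k)
    case 0
    have "in_thin_below G D l 0" by (simp add: in_thin_below_def)
    then show ?case using G l N by blast
  next
    case (Suc k)
    then obtain F D' l' where F: "in_splitting\<^sup>*\<^sup>* G F" "prepared F D'" "out_thin G D \<longrightarrow> out_thin F D'"
      "ranked_off F D' l'" "\<forall>v\<in>verts F. l' v < N" "in_thin_below F D' l' k" by blast
    have "fin_digraph F" "Digraph_Component.connected F" using F(2) by (simp_all add: prepared_def)
    then obtain H :: "(nat, nat) pre_digraph" and f g where H: "in_splitting F H"
      "Digraph_Component.connected H" "covering H F f g" "inj_on f {x \<in> verts H. f x \<in> D'}"
      "in_thin_below H {x \<in> verts H. f x \<in> D'} (l' \<circ> f) (Suc k)"
      using F(4,6) by (rule thinning_in_splitting)
    interpret covering H F f g by (rule H(3))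
    have "prepared H (lift D')"
      using F(2) H(2,4) H.fin_digraph inj_on_recurrent_arcs cycle_transversal_lift
      unfolding prepared_def by blast
    moreover have "in_splitting\<^sup>*\<^sup>* G H" using F(1) H(1) by (rule rtranclp.rtrancl_into_rtrancl)
    moreover have "out_thin G D \<longrightarrow> out_thin H (lift D')" using F(3) out_thin_lift by blast
    moreover have "ranked_off H (lift D') (l' \<circ> f)" using F(4) by (rule ranked_off_lift)
    moreover have "\<forall>v\<in>verts H. (l' \<circ> f) v < N" using F(5) verts_in by simp
    ultimately show ?case using H(5) by blast
  qed
  from this[OF bound, of "Suc (Max (l ` verts G))"] obtain F D' l' where
    F: "in_splitting\<^sup>*\<^sup>* G F" "prepared F D'" "out_thin G D \<longrightarrow> out_thin F D'"
    "\<forall>v\<in>verts F. l' v < Suc (Max (l ` verts G))"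
    "in_thin_below F D' l' (Suc (Max (l ` verts G)))" by blast
  have "in_thin F D'" using F(4,5) by (simp add: in_thin_def in_thin_below_def)
  then show thesis using that F(1-3) by blast
qed

lemma transpose_graph_simps [simp]:
  "verts (transpose_graph G) = verts G" "arcs (transpose_graph G) = arcs G"
  "tail (transpose_graph G) = head G" "head (transpose_graph G) = tail G"
  "in_arcs (transpose_graph G) = out_arcs G" "out_arcs (transpose_graph G) = in_arcs G"
  by (auto simp: transpose_graph_def in_arcs_def out_arcs_def)

lemma transpose_transpose_graph [simp]: "transpose_graph (transpose_graph G) = G"
  by (simp add: transpose_graph_def)

lemma arcs_ends_transpose_graph: "arcs_ends (transpose_graph G) = (arcs_ends G)\<inverse>"
  by (auto simp: arcs_ends_conv)

text \<open>
  Reversing all arcs reverses the ranks, and it exchanges the tails of the recurrent arcs with their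
  heads, on which injectivity is known by counting.
\<close>

lemma prepared_transpose_graph:
  assumes "prepared G D"
  shows "prepared (transpose_graph G) D"
proof -
  let ?T = "transpose_graph G"
  interpret fin_digraph G using assms by (simp add: prepared_def)
  have "fin_digraph ?T" by unfold_locales simp_all
  moreover have "Digraph_Component.connected ?T"
  proof -
    have "(arcs_ends ?T)\<^sup>s = (arcs_ends G)\<^sup>s"
      by (auto simp: arcs_ends_transpose_graph symcl_def)
    then show ?thesis using assms by (simp add: prepared_def connected_conv)
  qed
  moreover have "inj_on (tail ?T) (recurrent_arcs ?T)"
  proof -
    have "recurrent_arcs ?T = recurrent_arcs G"
      by (simp add: recurrent_arcs_def arcs_ends_transpose_graph rtrancl_converse)
    then show ?thesis using assms inj_on_head_recurrent_arcs by (simp add: prepared_def)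
  qed
  moreover have "cycle_transversal ?T D"
  proof -
    have D: "cycle_transversal G D" using assms by (simp add: prepared_def)
    then obtain l where l: "ranked_off G D l" unfolding cycle_transversal_def by blast
    define N where "N = Max (l ` verts G)"
    have N: "l v \<le> N" if "v \<in> verts G" for v using that by (simp add: N_def)
    have "ranked_off ?T D (\<lambda>v. N - l v)"
      unfolding ranked_off_def
    proof (intro ballI impI, elim conjE)
      fix e assume "e \<in> arcs ?T" "tail ?T e \<notin> D" "head ?T e \<notin> D"
      then have "l (tail G e) < l (head G e)" "l (head G e) \<le> N"
        using l N by (simp_all add: ranked_off_def)
      then show "N - l (tail ?T e) < N - l (head ?T e)" by simp
    qed
    moreover have "(d, d) \<in> (arcs_ends ?T)\<^sup>+" if "d \<in> D" for d
      using D that by (simp add: cycle_transversal_def arcs_ends_transpose_graph trancl_converse)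
    moreover have "d = d'" if "d \<in> D" "d' \<in> D" "(d, d') \<in> (arcs_ends ?T)\<^sup>*"
        "(d', d) \<in> (arcs_ends ?T)\<^sup>*" for d d'
      using D that unfolding cycle_transversal_def arcs_ends_transpose_graph rtrancl_converse
      by blast
    moreover have "D \<subseteq> verts ?T" using D by (simp add: cycle_transversal_def)
    ultimately show ?thesis unfolding cycle_transversal_def by blast
  qed
  ultimately show ?thesis by (simp add: prepared_def)
qed

lemma thin_transpose_graph:
  "in_thin (transpose_graph G) D \<longleftrightarrow> out_thin G D"
  "out_thin (transpose_graph G) D \<longleftrightarrow> in_thin G D"
  by (simp_all add: in_thin_def out_thin_def)

text \<open>
  In-splittings make the graph thin for incoming arcs; in-splittings of the transpose, that is,
  out-splittings, then do the same for outgoing arcs. The first achievement is not lost, because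
  the transposed splittings preserve the in-degrees.
\<close>

lemma thinning_splittings:
  fixes G :: "(nat, nat) pre_digraph"
  assumes "prepared G D"
  obtains F D' where "splitting_move\<^sup>*\<^sup>* G F" "prepared F D'" "in_thin F D'" "out_thin F D'"
proof -
  obtain F D1 where F: "in_splitting\<^sup>*\<^sup>* G F" "prepared F D1" "in_thin F D1"
    using thinning_in_splittings[OF assms] by blast
  obtain H D2 where H: "in_splitting\<^sup>*\<^sup>* (transpose_graph F) H" "prepared H D2"
      "in_thin H D2" "out_thin H D2"
    using thinning_in_splittings[OF prepared_transpose_graph[OF F(2)]] F(3)
    by (auto simp: thin_transpose_graph)
  have "splitting_move\<^sup>*\<^sup>* G F"
    using F(1) by (rule rtranclp_mono[THEN predicate2D, rotated]) (auto simp: splitting_move_def)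
  moreover have "splitting_move\<^sup>*\<^sup>* F (transpose_graph H)"
    using H(1)
  proof (induction rule: rtranclp_induct)
    case (step K L)
    have "splitting_move (transpose_graph K) (transpose_graph L)"
      using step.hyps(2) by (simp add: splitting_move_def out_splitting_def)
    with step.IH show ?case by (rule rtranclp.rtrancl_into_rtrancl)
  qed simp
  ultimately have "splitting_move\<^sup>*\<^sup>* G (transpose_graph H)" by (rule rtranclp_trans)
  then show thesis
    using that[of "transpose_graph H" D2] prepared_transpose_graph[OF H(2)] H(3,4)
    by (simp add: thin_transpose_graph)
qed

section \<open>Thin graphs are in quasi-normal form\<close>

lemma (in wf_digraph) awalk_ranked_off:
  assumes "ranked_off G D l"
    and "awalk x p y" "tail G ` set p \<inter> D = {}" "y \<notin> D"
  shows "l x + length p \<le> l y"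
  using assms(2-)
proof (induction p arbitrary: x)
  case Nil
  then show ?case by (simp add: awalk_simps)
next
  case (Cons e p)
  then have e: "e \<in> arcs G" "x = tail G e" "awalk (head G e) p y" "tail G e \<notin> D"
    by (simp_all add: awalk_simps)
  have "head G e \<notin> D"
    using e(3) Cons.prems(2,3) by (cases p) (simp_all add: awalk_simps)
  then have "l x < l (head G e)" using assms(1) e by (simp add: ranked_off_def)
  moreover have "l (head G e) + length p \<le> l y"
    using Cons.prems(2,3) by (intro Cons.IH e(3)) auto
  ultimately show ?case by simp
qed

lemma (in wf_digraph) cycle_meets_transversal:
  assumes "cycle_transversal G D" "cycle p"
  shows "tail G ` set p \<inter> D \<noteq> {}"
proof
  assume *: "tail G ` set p \<inter> D = {}"
  obtain l where l: "ranked_off G D l" using assms(1) unfolding cycle_transversal_def by blast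
  obtain u where u: "awalk u p u" "p \<noteq> []" using assms(2) by (rule cycleE)
  then have "u \<in> tail G ` set p" by (cases p) (simp_all add: awalk_simps)
  with * have "u \<notin> D" by blast
  from awalk_ranked_off[OF l u(1) * this] u(2) show False by simp
qed

lemma (in wf_digraph) cycle_verts_reachable:
  assumes "cycle p" "x \<in> tail G ` set p" "y \<in> tail G ` set p"
  shows "(x, y) \<in> (arcs_ends G)\<^sup>*"
proof -
  obtain e where e: "e \<in> set p" "x = tail G e" using assms(2) by (elim imageE)
  obtain f where f: "f \<in> set p" "y = tail G f" using assms(3) by (elim imageE)
  obtain q where q: "awalk (head G e) q (tail G e)" "set (e # q) = set p"
    using assms(1) e(1) by (rule cycle_at)
  have "e \<in> arcs G" using assms(1) e(1) by (auto simp: cycle_def awalk_def)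
  then have "awalk x (e # q) x" using q(1) e(2) by (simp add: awalk_Cons_iff)
  moreover have "f \<in> set (e # q)" using q(2) f(1) by blast
  then have "y \<in> set (awalk_verts x (e # q))"
    using f(2) awalk_verts_arc1[OF \<open>f \<in> set (e # q)\<close>] by simp
  ultimately show ?thesis using awalk_verts_reachable_from reachable_rtranclI by metis
qed

context fin_digraph
begin

lemma out_thin_unique:
  assumes "out_thin G D" "v \<notin> D" "a \<in> arcs G" "head G a = v"
    and "e \<in> arcs G" "tail G e = v" "f \<in> arcs G" "tail G f = v"
  shows "e = f"
proof -
  have "v \<in> verts G - D" "a \<in> in_arcs G v" using assms by auto
  then have "card (out_arcs G v) \<le> 1" using assms(1) unfolding out_thin_def by blast
  moreover have "finite (out_arcs G v)" by (simp add: out_arcs_def)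
  ultimately have "\<forall>e\<in>out_arcs G v. \<forall>f\<in>out_arcs G v. e = f"
    by (simp only: One_nat_def card_le_Suc0_iff_eq)
  moreover have "e \<in> out_arcs G v" "f \<in> out_arcs G v" using assms by simp_all
  ultimately show ?thesis by blast
qed

lemma in_thin_unique:
  assumes "in_thin G D" "v \<notin> D" "a \<in> arcs G" "tail G a = v"
    and "e \<in> arcs G" "head G e = v" "f \<in> arcs G" "head G f = v"
  shows "e = f"
proof -
  have "v \<in> verts G - D" "a \<in> out_arcs G v" using assms by auto
  then have "card (in_arcs G v) \<le> 1" using assms(1) unfolding in_thin_def by blast
  moreover have "finite (in_arcs G v)" by (simp add: in_arcs_def)
  ultimately have "\<forall>e\<in>in_arcs G v. \<forall>f\<in>in_arcs G v. e = f"
    by (simp only: One_nat_def card_le_Suc0_iff_eq)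
  moreover have "e \<in> in_arcs G v" "f \<in> in_arcs G v" using assms by simp_all
  ultimately show ?thesis by blast
qed

lemma cycle_trailE:
  assumes "cycle_trail G p"
  obtains u v where "awalk u p v" "p \<noteq> []" "u \<in> cyclic_verts G" "v \<in> cyclic_verts G"
    "\<forall>e\<in>set (tl p). tail G e \<notin> cyclic_verts G" "trail_source G p = u" "trail_range G p = v"
proof -
  obtain u v where p: "awalk u p v" "u \<in> cyclic_verts G" "v \<in> cyclic_verts G" "p \<noteq> []"
    "\<forall>e\<in>set (tl p). tail G e \<notin> cyclic_verts G"
    using assms unfolding cycle_trail_def by blast
  have "trail_source G p = u" using p(1,4) by (cases p) (simp_all add: trail_source_def awalk_simps)
  moreover have "trail_range G p = v"
    using p(1,4) by (cases p rule: rev_cases) (simp_all add: trail_range_def awalk_simps)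
  ultimately show thesis using that p by blast
qed

lemma cycle_trail_split:
  assumes "cycle_trail G p" "w \<in> interior_verts G p"
  obtains u p1 a b p2 v where "p = p1 @ p2"
    "awalk u p1 w" "u \<in> cyclic_verts G" "\<forall>e\<in>set (tl p1). tail G e \<notin> cyclic_verts G"
    "awalk w p2 v" "v \<in> cyclic_verts G" "\<forall>e\<in>set p2. tail G e \<notin> cyclic_verts G"
    "a \<in> arcs G" "head G a = w" "b \<in> arcs G" "tail G b = w"
proof -
  obtain u v where p: "awalk u p v" "u \<in> cyclic_verts G" "v \<in> cyclic_verts G" "p \<noteq> []"
    "\<forall>e\<in>set (tl p). tail G e \<notin> cyclic_verts G"
    using assms(1) by (rule cycle_trailE)
  have w: "w \<notin> cyclic_verts G" "w \<in> tail G ` set p \<or> w \<in> head G ` set p"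
    using assms(2) by (simp_all add: interior_verts_def)
  have "\<exists>p1 p2. p = p1 @ p2 \<and> awalk u p1 w \<and> awalk w p2 v"
    using w(2)
  proof
    assume "w \<in> tail G ` set p"
    then obtain e where e: "e \<in> set p" "w = tail G e" by (elim imageE)
    obtain xs ys where "p = xs @ e # ys" using split_list[OF e(1)] by blast
    then have "p = xs @ e # ys \<and> awalk u xs w \<and> awalk w (e # ys) v"
      using p(1) by (auto simp: awalk_append_iff awalk_Cons_iff e(2))
    then show ?thesis by blast
  next
    assume "w \<in> head G ` set p"
    then obtain e where e: "e \<in> set p" "w = head G e" by (elim imageE)
    obtain xs ys where "p = xs @ e # ys" using split_list[OF e(1)] by blast
    then have "p = (xs @ [e]) @ ys \<and> awalk u (xs @ [e]) w \<and> awalk w ys v"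
      using p(1) by (auto simp: awalk_append_iff awalk_simps e(2))
    then show ?thesis by blast
  qed
  then obtain p1 p2 where s: "p = p1 @ p2" "awalk u p1 w" "awalk w p2 v" by blast
  have "p1 \<noteq> []" using s(2) w(1) p(2) by (auto simp: awalk_simps)
  then obtain a p1' where a: "p1 = p1' @ [a]" by (cases p1 rule: rev_cases) simp_all
  have "p2 \<noteq> []" using s(3) w(1) p(3) by (auto simp: awalk_simps)
  then obtain b p2' where b: "p2 = b # p2'" by (cases p2) simp_all
  have "\<forall>e\<in>set (tl p1) \<union> set p2. tail G e \<notin> cyclic_verts G"
    using p(5) \<open>p1 \<noteq> []\<close> by (simp add: s(1))
  moreover have "a \<in> arcs G" "head G a = w" using s(2) by (simp_all add: a awalk_simps)
  moreover have "b \<in> arcs G" "tail G b = w" using s(3) by (simp_all add: b awalk_simps)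
  ultimately show thesis using that[OF s(1,2) p(2) _ s(3) p(3)] by simp
qed

context
  fixes D
  assumes thin: "out_thin G D" "in_thin G D" and D_cyclic: "D \<subseteq> cyclic_verts G"
begin

text \<open>
  The interior vertices of a trail have an arc entering and an arc leaving them, so in a thin graph
  they determine both arcs. From an interior vertex, a trail can therefore be reconstructed forwards
  and backwards, up to the cyclic vertices where it has to stop.
\<close>

lemma walk_to_cycles_unique:
  assumes "awalk w p v" "v \<in> cyclic_verts G" "\<forall>e\<in>set p. tail G e \<notin> cyclic_verts G"
    and "awalk w q v'" "v' \<in> cyclic_verts G" "\<forall>e\<in>set q. tail G e \<notin> cyclic_verts G"
    and "a \<in> arcs G" "head G a = w"
  shows "p = q"
  using assms
proof (induction p arbitrary: w q a)
  case Nil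
  then show ?case by (cases q) (simp_all add: awalk_simps)
next
  case (Cons e p)
  then obtain f q' where q: "q = f # q'" by (cases q) (simp_all add: awalk_simps)
  have e: "e \<in> arcs G" "tail G e = w" "awalk (head G e) p v"
    and f: "f \<in> arcs G" "tail G f = w" "awalk (head G f) q' v'"
    using Cons.prems by (simp_all add: q awalk_simps)
  have "w \<notin> D" using Cons.prems(3) D_cyclic e(2) by auto
  then have "e = f"
    using Cons.prems(7,8) e(1,2) f(1,2) by (rule out_thin_unique[OF thin(1)])
  moreover have "p = q'"
    using Cons.prems(2,3,5,6) e(1,3) f(3)
    by (intro Cons.IH[of "head G e" q' e]) (simp_all add: q \<open>e = f\<close>)
  ultimately show ?case by (simp add: q)
qed

lemma walk_from_cycles_unique:
  assumes "awalk u p w" "u \<in> cyclic_verts G" "\<forall>e\<in>set (tl p). tail G e \<notin> cyclic_verts G"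
    and "awalk u' q w" "u' \<in> cyclic_verts G" "\<forall>e\<in>set (tl q). tail G e \<notin> cyclic_verts G"
    and "w \<notin> cyclic_verts G" "a \<in> arcs G" "tail G a = w"
  shows "p = q"
  using assms
proof (induction p arbitrary: w q a rule: rev_induct)
  case Nil
  then show ?case by (simp add: awalk_simps)
next
  case (snoc e p)
  have "q \<noteq> []" using snoc.prems(4,5,7) by (auto simp: awalk_simps)
  then obtain q' f where q: "q = q' @ [f]" by (cases q rule: rev_cases) simp_all
  have e: "e \<in> arcs G" "head G e = w" "awalk u p (tail G e)"
    and f: "f \<in> arcs G" "head G f = w" "awalk u' q' (tail G f)"
    using snoc.prems(1,4) by (auto simp: q awalk_simps)
  have "w \<notin> D" using snoc.prems(7) D_cyclic by blast
  then have ef: "e = f"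
    using snoc.prems(8,9) e(1,2) f(1,2) by (rule in_thin_unique[OF thin(2)])
  have inner: "p \<noteq> [] \<longleftrightarrow> tail G e \<notin> cyclic_verts G"
    using snoc.prems(2,3) e(3) by (cases p) (simp_all add: awalk_simps)
  have inner': "q' \<noteq> [] \<longleftrightarrow> tail G e \<notin> cyclic_verts G"
    using snoc.prems(5,6) f(3) by (cases q') (simp_all add: q ef awalk_simps)
  have "p = q'"
  proof (cases "p = []")
    case True
    then show ?thesis using inner inner' by blast
  next
    case False
    then have "q' \<noteq> []" "tail G e \<notin> cyclic_verts G" using inner inner' by blast+
    with False show ?thesis
      using snoc.prems(2,3,5,6) e(1,3) f(3)
      by (intro snoc.IH[of "tail G e" q' e]) (simp_all add: q ef)
  qed
  then show ?case by (simp add: q ef)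
qed

lemma cycle_trails_disjoint:
  assumes "cycle_trail G p" "cycle_trail G q" "w \<in> interior_verts G p" "w \<in> interior_verts G q"
  shows "p = q"
proof -
  have w: "w \<notin> cyclic_verts G" using assms(3) by (simp add: interior_verts_def)
  obtain u p1 a b p2 v where p: "p = p1 @ p2"
    "awalk u p1 w" "u \<in> cyclic_verts G" "\<forall>e\<in>set (tl p1). tail G e \<notin> cyclic_verts G"
    "awalk w p2 v" "v \<in> cyclic_verts G" "\<forall>e\<in>set p2. tail G e \<notin> cyclic_verts G"
    "a \<in> arcs G" "head G a = w" "b \<in> arcs G" "tail G b = w"
    using assms(1,3) by (rule cycle_trail_split)
  obtain u' q1 a' b' q2 v' where q: "q = q1 @ q2"
    "awalk u' q1 w" "u' \<in> cyclic_verts G" "\<forall>e\<in>set (tl q1). tail G e \<notin> cyclic_verts G"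
    "awalk w q2 v'" "v' \<in> cyclic_verts G" "\<forall>e\<in>set q2. tail G e \<notin> cyclic_verts G"
    using assms(2,4) by (rule cycle_trail_split)
  have "p1 = q1" using p(2-4) q(2-4) w p(10,11) by (rule walk_from_cycles_unique)
  moreover have "p2 = q2" using p(5-7) q(5-7) p(8,9) by (rule walk_to_cycles_unique)
  ultimately show ?thesis by (simp add: p(1) q(1))
qed

text \<open>
  Off the transversal, a vertex of a cycle has the arc of the cycle as its only outgoing arc. A trail
  starting there runs along this arc and, having reached a cyclic vertex, stops on the same cycle.
\<close>

lemma trail_leaving_cycle:
  assumes "cycle c" "cycle_trail G p" "trail_source G p \<in> tail G ` set c" "trail_source G p \<notin> D"
  shows "trail_range G p \<in> tail G ` set c"
proof -
  obtain u v where p: "awalk u p v" "p \<noteq> []" "u \<in> cyclic_verts G" "v \<in> cyclic_verts G"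
    "\<forall>e\<in>set (tl p). tail G e \<notin> cyclic_verts G" "trail_source G p = u" "trail_range G p = v"
    using assms(2) by (rule cycle_trailE)
  obtain x where c: "awalk x c x" "head G ` set c = tail G ` set c" using assms(1) by (rule cycleE)
  have c_arcs: "set c \<subseteq> arcs G" using c(1) by (simp add: awalk_def)
  have u: "u \<in> tail G ` set c" "u \<notin> D" using assms(3,4) p(6) by simp_all
  obtain e where e: "e \<in> set c" "u = tail G e" using u(1) by (elim imageE)
  have "u \<in> head G ` set c" using u(1) c(2) by simp
  then obtain a where a: "a \<in> set c" "u = head G a" by (elim imageE)
  obtain f q where fq: "p = f # q" using p(2) by (cases p) simp_all
  have f: "f \<in> arcs G" "tail G f = u" "awalk (head G f) q v"
    using p(1) by (simp_all add: fq awalk_simps)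
  have "f = e" using u(2) subsetD[OF c_arcs a(1)] a(2)[symmetric] f(1,2) subsetD[OF c_arcs e(1)]
      e(2)[symmetric] by (rule out_thin_unique[OF thin(1)])
  then have h: "head G f \<in> tail G ` set c" using e(1) c(2) by blast
  have "tail G ` set c \<subseteq> cyclic_verts G"
    using assms(1) unfolding cyclic_verts_def cycles_of_def by (auto simp: cycle_verts_rotations)
  with h have "head G f \<in> cyclic_verts G" by blast
  then have "q = []" using p(5) f(3) by (cases q) (simp_all add: fq awalk_simps)
  then show ?thesis using f(3) h p(7) by (simp add: awalk_simps)
qed

lemma trail_entering_cycle:
  assumes "cycle c" "cycle_trail G p" "trail_range G p \<in> tail G ` set c" "trail_range G p \<notin> D"
  shows "trail_source G p \<in> tail G ` set c"
proof -
  obtain u v where p: "awalk u p v" "p \<noteq> []" "u \<in> cyclic_verts G" "v \<in> cyclic_verts G"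
    "\<forall>e\<in>set (tl p). tail G e \<notin> cyclic_verts G" "trail_source G p = u" "trail_range G p = v"
    using assms(2) by (rule cycle_trailE)
  obtain x where c: "awalk x c x" "head G ` set c = tail G ` set c" using assms(1) by (rule cycleE)
  have c_arcs: "set c \<subseteq> arcs G" using c(1) by (simp add: awalk_def)
  have v: "v \<in> tail G ` set c" "v \<notin> D" using assms(3,4) p(7) by simp_all
  obtain a where a: "a \<in> set c" "v = tail G a" using v(1) by (elim imageE)
  have "v \<in> head G ` set c" using v(1) c(2) by simp
  then obtain e where e: "e \<in> set c" "v = head G e" by (elim imageE)
  obtain f q where fq: "p = q @ [f]" using p(2) by (cases p rule: rev_cases) simp_all
  have f: "f \<in> arcs G" "head G f = v" "awalk u q (tail G f)"
    using p(1) by (auto simp: fq awalk_simps)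
  have "f = e" using v(2) subsetD[OF c_arcs a(1)] a(2)[symmetric] f(1,2) subsetD[OF c_arcs e(1)]
      e(2)[symmetric] by (rule in_thin_unique[OF thin(2)])
  then have h: "tail G f \<in> tail G ` set c" using e(1) by blast
  have "tail G ` set c \<subseteq> cyclic_verts G"
    using assms(1) unfolding cyclic_verts_def cycles_of_def by (auto simp: cycle_verts_rotations)
  with h have "tail G f \<in> cyclic_verts G" by blast
  then have "q = []" using p(5) by (cases q) (simp_all add: fq)
  then show ?thesis using f(3) h p(6) by (simp add: awalk_simps)
qed

end

end

text \<open>
  The transversal provides the distinguished vertices: a trail between different cycles can leave a
  cycle, and enter one, only there.
\<close>

lemma thin_imp_quasi_normal_form:
  assumes prep: "prepared G D" and thin: "out_thin G D" "in_thin G D"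
  shows "quasi_normal_form G"
proof -
  interpret fin_digraph G using prep by (simp add: prepared_def)
  have D: "cycle_transversal G D" using prep by (simp add: prepared_def)
  have D_cyclic: "D \<subseteq> cyclic_verts G"
    using D by (auto simp: cycle_transversal_def cyclic_verts_iff)
  have disj: "disjoint_cycles G"
    using prep by (simp add: prepared_def disjoint_cycles_iff_inj_on_recurrent_arcs)
  have same: "A = B" if "A \<in> cycles_of G" "B \<in> cycles_of G" "x \<in> cycle_verts G A" "x \<in> cycle_verts G B"
    for A B x
  proof -
    have "x \<in> cyclic_verts G" using that(1,3) unfolding cyclic_verts_def by blast
    then have "x \<in> verts G" using reachable1_in_verts(1) by (simp add: cyclic_verts_iff)
    then show ?thesis using disj that unfolding disjoint_cycles_def by (blast dest: Uniq_D)
  qed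
  have cyc: "\<exists>c. cycle c \<and> cycle_verts G C = tail G ` set c" if "C \<in> cycles_of G" for C
    using that unfolding cycles_of_def by (auto simp: cycle_verts_rotations)
  define d where "d C = (SOME x. x \<in> cycle_verts G C \<inter> D)" for C
  have d: "d C \<in> cycle_verts G C \<inter> D" if "C \<in> cycles_of G" for C
  proof -
    have "cycle_verts G C \<inter> D \<noteq> {}" using cyc[OF that] cycle_meets_transversal[OF D] by metis
    then show ?thesis unfolding d_def by (rule some_in_eq[THEN iffD2])
  qed
  have d_unique: "x = d C" if C: "C \<in> cycles_of G" and x: "x \<in> cycle_verts G C" "x \<in> D" for C x
  proof -
    obtain c where c: "cycle c" "cycle_verts G C = tail G ` set c" using cyc[OF C] by blast
    have "d C \<in> tail G ` set c" "d C \<in> D" "x \<in> tail G ` set c"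
      using d[OF C] x(1) c(2) by simp_all
    then have "(x, d C) \<in> (arcs_ends G)\<^sup>*" "(d C, x) \<in> (arcs_ends G)\<^sup>*"
      using cycle_verts_reachable[OF c(1)] by blast+
    then show ?thesis using D \<open>d C \<in> D\<close> x(2) unfolding cycle_transversal_def by blast
  qed
  have ends: "trail_source G p = d A \<and> trail_range G p = d B"
    if A: "A \<in> cycles_of G" and B: "B \<in> cycles_of G" and "A \<noteq> B"
      and p: "cycle_trail_between G A p B" for A B p
  proof -
    have tr: "cycle_trail G p" and src: "trail_source G p \<in> cycle_verts G A"
      and rng: "trail_range G p \<in> cycle_verts G B"
      using p by (simp_all add: cycle_trail_between_def)
    obtain a where a: "cycle a" "cycle_verts G A = tail G ` set a" using cyc[OF A] by blast
    obtain b where b: "cycle b" "cycle_verts G B = tail G ` set b" using cyc[OF B] by blast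
    have "trail_source G p \<in> D"
    proof (rule ccontr)
      assume "trail_source G p \<notin> D"
      then have "trail_range G p \<in> cycle_verts G A"
        using trail_leaving_cycle[OF thin D_cyclic a(1) tr] src a(2) by simp
      then show False using same[OF A B _ rng] \<open>A \<noteq> B\<close> by blast
    qed
    moreover have "trail_range G p \<in> D"
    proof (rule ccontr)
      assume "trail_range G p \<notin> D"
      then have "trail_source G p \<in> cycle_verts G B"
        using trail_entering_cycle[OF thin D_cyclic b(1) tr] rng b(2) by simp
      then show False using same[OF A B src] \<open>A \<noteq> B\<close> by blast
    qed
    ultimately show ?thesis using d_unique[OF A src] d_unique[OF B rng] by blast
  qed
  have "interior_verts G p \<inter> interior_verts G q = {}"
    if "cycle_trail G p" "cycle_trail G q" "p \<noteq> q" for p q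
    using cycle_trails_disjoint[OF thin D_cyclic that(1,2)] that(3) by blast
  moreover have "\<forall>C\<in>cycles_of G. d C \<in> cycle_verts G C" using d by blast
  ultimately show ?thesis
    using prep disj ends fin_digraph unfolding quasi_normal_form_def prepared_def by blast
qed

theorem theorem3p8:
  fixes E :: "('a, 'b) pre_digraph"
  assumes "fin_digraph E" and "Digraph_Component.connected E" and "disjoint_cycles E"
  shows "\<exists>F :: (nat, nat) pre_digraph. transformable E F \<and> quasi_normal_form F"
proof -
  interpret E: fin_digraph E by fact
  obtain E' :: "(nat, nat) pre_digraph" and f g where E': "digraph_iso E E'" "fin_digraph E'"
    "Digraph_Component.connected E \<longrightarrow> Digraph_Component.connected E'"
    "covering E' E f g" "inj_on f (verts E')"
    "\<forall>x\<in>verts E'. card (in_arcs E' x) = card (in_arcs E (f x))"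
    by (rule nat_graph_isomorphic[OF E.fin_digraph])
  interpret E': covering E' E f g by (rule E'(4))
  have inj: "inj_on (tail E') (recurrent_arcs E')"
    using assms(3) E.disjoint_cycles_iff_inj_on_recurrent_arcs E'.inj_on_recurrent_arcs by blast
  obtain D where "cycle_transversal E' D" using E'.H.cycle_transversal_exists[OF inj] .
  then have "prepared E' D"
    using inj E'(2,3) assms(2) by (simp add: prepared_def)
  then obtain F D' where "splitting_move\<^sup>*\<^sup>* E' F" "prepared F D'" "in_thin F D'" "out_thin F D'"
    by (rule thinning_splittings)
  moreover have "splitting_move E E'" using E'(1) by (simp add: splitting_move_def)
  ultimately have "transformable E F \<and> quasi_normal_form F"
    unfolding transformable_def using thin_imp_quasi_normal_form by blast
  then show ?thesis by blast
qed

end
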